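(* Let $M$ be a spacelike helicoidal surface of type I, II or III in the Lorentzian $n$-space $\mathbb{E}^n_1$, with translation constant $c>0$, and let $\alpha(u)={\bf x}(u,v(u))$ (where ${\bf x}$ is ${\bf x}_I$, ${\bf x}_{II}$ or ${\bf x}_{III}$, respectively) be a spacelike loxodrome on $M$ which makes the constant Lorentzian spacelike angle $\theta_0$ with the meridians of $M$ and satisfies $v(u_0)=0$. Then $\alpha$ has the following parametrization, for one of the two choices of the sign $\pm$: (i) for the helicoidal surface of type I, $$\alpha_I(u)=(x_1(u)\cos v(u),\,x_1(u)\sin v(u),\,x_3(u),\dots,x_{n-1}(u),\,x_n(u)+cv(u)),$$ where $$v(u)=\int_{u_0}^u\frac{-2c\sin^2\theta_0\,x_n'(\xi)\pm\sqrt{\sin^2 2\theta_0\,\bigl(x_1^2(\xi)-c^2(1+x_n'^2(\xi))\bigr)}}{2\cos^2\theta_0\,(x_1^2(\xi)-c^2)-2c^2x_n'^2(\xi)}\,d\xi,$$ provided that $\cos^2\theta_0\,(x_1^2(\xi)-c^2)-c^2x_n'^2(\xi)\neq0$; (ii) for the helicoidal surface of type II, $$\alpha_{II}(u)=(x_1(u)+cv(u),\,x_2(u),\dots,x_{n-2}(u),\,x_n(u)\sinh v(u),\,x_n(u)\cosh v(u)),$$ where $$v(u)=\int_{u_0}^u\frac{2c\,x_1'(\xi)\sin^2\theta_0\pm\sqrt{\sin^2 2\theta_0\,\bigl(x_n^2(\xi)+c^2(1-x_1'^2(\xi))\bigr)}}{2\cos^2\theta_0\,(c^2+x_n^2(\xi))-2c^2x_1'^2(\xi)}\,d\xi,$$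 provided that $\cos^2\theta_0\,(c^2+x_n^2(\xi))-c^2x_1'^2(\xi)\neq0$; (iii) for the helicoidal surface of type III, $$\alpha_{III}(u)=x_1(u)e_1+\sqrt2\,v(u)x_n(u)e_2+x_3(u)e_3+\cdots+x_{n-2}(u)e_{n-2}+\bigl(x_{n-1}(u)+v^2(u)x_n(u)+cv(u)\bigr)\xi_{n-1}+x_n(u)\xi_n,$$ where $$v(u)=\int_{u_0}^u\frac{-2c\,x_n'(\xi)\sin^2\theta_0\pm\sqrt{\sin^2 2\theta_0\,\bigl(2x_n^2(\xi)-c^2x_n'^2(\xi)\bigr)}}{4\cos^2\theta_0\,x_n^2(\xi)-2c^2x_n'^2(\xi)}\,d\xi,$$ provided that $2\cos^2\theta_0\,x_n^2(\xi)-c^2x_n'^2(\xi)\neq0$.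
   Context: **Lorentzian space.** $\mathbb{E}^n_1$ is $\mathbb{R}^n$ with $\langle x,y\rangle=x_1y_1+\cdots+x_{n-1}y_{n-1}-x_ny_n$, and $\|x\|=\sqrt{|\langle x,x\rangle|}$. A vector $x$ is spacelike if $\langle x,x\rangle>0$ or $x=0$, timelike if $\langle x,x\rangle<0$, lightlike if $\langle x,x\rangle=0$ and $x\ne0$. A smooth curve is spacelike if its velocity vectors are spacelike. Here $n\ge3$ for types I and II and $n\ge4$ for type III. $\{e_1,\dots,e_n\}$ is the standard orthonormal basis, and $\xi_{n-1}=\frac1{\sqrt2}(e_n-e_{n-1})$, $\xi_n=\frac1{\sqrt2}(e_n+e_{n-1})$, so that $\langle\xi_{n-1},\xi_{n-1}\rangle=\langle\xi_n,\xi_n\rangle=0$, $\langle\xi_{n-1},\xi_n\rangle=-1$. **Surfaces.** For a surface ${\bf x}(u,v)$ put $E=\langle{\bf x}_u,{\bf x}_u\rangle$, $F=\langle{\bf x}_u,{\bf x}_v\rangle$, $G=\langle{\bf x}_v,{\bf x}_v\rangle$. The surface is spacelike if $EG-F^2>0$ and timelike if $EG-F^2<0$. **Helicoidal surfaces.** Let $c>0$ be a constant and $\varepsilon=\pm1$. A helicoidal surface is generated by rotating a smooth profile curve $\beta$ lying in a hyperplane about an $(n-2)$-plane and simultaneously translating it along a line $\ell$ (parallel to that $(n-2)$-plane and not meeting $\beta$). $u$ is the arc length parameter of $\beta$, ranging over an interval. Type I ($\ell$ spanned by $e_n$): $\beta_I(u)=(x_1(u),0,x_3(u),\dots,x_n(u))$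 with $x_1'^2+x_3'^2+\cdots+x_{n-1}'^2-x_n'^2=\varepsilon$, and $${\bf x}_I(u,v)=(x_1(u)\cos v,\,x_1(u)\sin v,\,x_3(u),\dots,x_{n-1}(u),\,x_n(u)+cv).$$ Type II ($\ell$ spanned by $e_1$): $\beta_{II}(u)=(x_1(u),\dots,x_{n-2}(u),0,x_n(u))$ with $x_1'^2+\cdots+x_{n-2}'^2-x_n'^2=\varepsilon$, and $${\bf x}_{II}(u,v)=(x_1(u)+cv,\,x_2(u),\dots,x_{n-2}(u),\,x_n(u)\sinh v,\,x_n(u)\cosh v).$$ Type III ($\ell$ spanned by $\xi_{n-1}$): $\beta_{III}(u)=x_1(u)e_1+x_3(u)e_3+\cdots+x_{n-2}(u)e_{n-2}+x_{n-1}(u)\xi_{n-1}+x_n(u)\xi_n$ with $x_1'^2+\sum_{i=3}^{n-2}x_i'^2-2x_{n-1}'x_n'=\varepsilon$, and $${\bf x}_{III}(u,v)=x_1(u)e_1+\sqrt2\,v\,x_n(u)e_2+x_3(u)e_3+\cdots+x_{n-2}(u)e_{n-2}+(x_{n-1}(u)+v^2x_n(u)+cv)\xi_{n-1}+x_n(u)\xi_n.$$ In all types $v$ is a real parameter. The meridians are the curves $v=\text{const}$, with tangent ${\bf x}_u$ and $\langle{\bf x}_u,{\bf x}_u\rangle=\varepsilon$. On the spacelike surfaces considered here the meridians are spacelike, i.e. $\varepsilon=1$. **Angle and loxodromes.** For spacelike vectors $x,y$ spanning a spacelike subspace, the Lorentzian spacelike angle is the unique $\theta\in[0,\pi]$ with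 $\langle x,y\rangle=\|x\|\|y\|\cos\theta$. A spacelike loxodrome on a spacelike helicoidal surface is a spacelike curve $\alpha(u)={\bf x}(u,v(u))$ on it (with $v$ a smooth function of $u$) whose tangent vector $\alpha'(u)$ makes a constant Lorentzian spacelike angle $\theta_0$ with the meridian direction ${\bf x}_u$ at every point. *)

theory Defs
  imports "HOL-Analysis.Analysis"
begin

text \<open>
  Lorentzian \<open>n\<close>-space is \<open>real ^ 'n\<close> with \<open>n = CARD('n)\<close>.  The coordinates have to be numbered
  \<open>1, \<dots>, n\<close>, the last one being the time coordinate; \<open>ix\<close> numbers the elements of the finite
  index type along its linear order.
\<close>

definition ix :: "nat \<Rightarrow> 'n::{finite,linorder}" where
  "ix i = sorted_list_of_set (UNIV :: 'n set) ! (i - 1)"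

lemma bij_betw_ix: "bij_betw (ix :: nat \<Rightarrow> 'n::{finite,linorder}) {1..CARD('n)} UNIV"
proof -
  let ?l = "sorted_list_of_set (UNIV :: 'n set)"
  have "bij_betw ((!) ?l) {..<CARD('n)} UNIV"
    by (rule bij_betw_nth) auto
  moreover have "bij_betw (\<lambda>i. i - 1) {1..CARD('n)} {..<CARD('n)}"
    by (rule bij_betw_byWitness[where f' = Suc]) auto
  ultimately have "bij_betw ((!) ?l \<circ> (\<lambda>i. i - 1)) {1..CARD('n)} UNIV"
    by (rule bij_betw_trans[rotated])
  then show ?thesis
    by (simp add: ix_def[abs_def] comp_def)
qed

definition e :: "nat \<Rightarrow> real ^ 'n::{finite,linorder}" where
  "e i = axis (ix i) 1"

definition lorentz :: "real ^ 'n::{finite,linorder} \<Rightarrow> real ^ 'n::{finite,linorder} \<Rightarrow> real" where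
  "lorentz x y =
     (\<Sum>i = 1..CARD('n) - 1. x $ ix i * y $ ix i) - x $ ix CARD('n) * y $ ix CARD('n)"

definition lnorm :: "real ^ 'n::{finite,linorder} \<Rightarrow> real" where
  "lnorm x = sqrt \<bar>lorentz x x\<bar>"

definition spacelike :: "real ^ 'n::{finite,linorder} \<Rightarrow> bool" where
  "spacelike x \<longleftrightarrow> lorentz x x > 0 \<or> x = 0"

definition spacelike_subspace :: "(real ^ 'n::{finite,linorder}) set \<Rightarrow> bool" where
  "spacelike_subspace V \<longleftrightarrow> subspace V \<and> (\<forall>x\<in>V. spacelike x)"

text \<open>\<open>\<xi>\<^sub>n\<^sub>-\<^sub>1\<close> and \<open>\<xi>\<^sub>n\<close>.\<close>

definition xi_pred :: "real ^ 'n::{finite,linorder}" where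
  "xi_pred = (1 / sqrt 2) *\<^sub>R (e CARD('n) - e (CARD('n) - 1))"

definition xi_last :: "real ^ 'n::{finite,linorder}" where
  "xi_last = (1 / sqrt 2) *\<^sub>R (e CARD('n) + e (CARD('n) - 1))"

text \<open>
  The angle is only meaningful for nonzero spacelike vectors spanning a spacelike subspace;
  see \<open>spacelike_angle\<close> below.
\<close>

definition spacelike_angle :: "real ^ 'n::{finite,linorder} \<Rightarrow> real ^ 'n::{finite,linorder} \<Rightarrow> real" where
  "spacelike_angle x y =
     (THE \<theta>. \<theta> \<in> {0..pi} \<and> lorentz x y = lnorm x * lnorm y * cos \<theta>)"

lemma lorentz_commute: "lorentz x y = lorentz y x"
  by (simp add: lorentz_def mult.commute)

lemma lorentz_zero: "lorentz 0 z = 0"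
  by (simp add: lorentz_def)

lemma lorentz_add_left: "lorentz (x + y) z = lorentz x z + lorentz y z"
  by (simp add: lorentz_def algebra_simps sum.distrib)

lemma lorentz_scaleR_left: "lorentz (a *\<^sub>R x) z = a * lorentz x z"
  by (simp add: lorentz_def algebra_simps sum_distrib_left)

lemma spacelike_angle:
  assumes "spacelike x" "spacelike y" "x \<noteq> 0" "y \<noteq> 0" "spacelike_subspace (span {x, y})"
  shows "spacelike_angle x y \<in> {0..pi}"
    and "lorentz x y = lnorm x * lnorm y * cos (spacelike_angle x y)"
proof -
  have px: "lorentz x x > 0" and py: "lorentz y y > 0"
    using assms by (auto simp: spacelike_def)
  define w where "w = lorentz y y *\<^sub>R x + (- lorentz x y) *\<^sub>R y"
  have "w \<in> span {x, y}"
    unfolding w_def by (intro span_add span_scale span_base) auto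
  then have "lorentz w w \<ge> 0"
    using assms(5) by (auto simp: spacelike_subspace_def spacelike_def lorentz_zero)
  moreover have "lorentz w w = lorentz y y * (lorentz x x * lorentz y y - (lorentz x y)\<^sup>2)"
  proof -
    have wz: "lorentz w z = lorentz y y * lorentz x z - lorentz x y * lorentz y z" for z
      by (simp only: w_def lorentz_add_left lorentz_scaleR_left)
    have "lorentz x w = lorentz y y * lorentz x x - lorentz x y * lorentz x y"
      unfolding lorentz_commute[of x w] wz lorentz_commute[of y x] ..
    moreover have "lorentz y w = 0"
      unfolding lorentz_commute[of y w] wz by simp
    ultimately show ?thesis
      unfolding wz[of w] by (simp add: power2_eq_square mult.commute)
  qed
  ultimately have "(lorentz x y)\<^sup>2 \<le> lorentz x x * lorentz y y"
    using py by (simp add: zero_le_mult_iff)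
  then have "\<bar>lorentz x y\<bar> \<le> sqrt (lorentz x x * lorentz y y)"
    by (simp add: real_le_rsqrt)
  then have "\<bar>lorentz x y\<bar> \<le> lnorm x * lnorm y"
    using px py by (simp add: lnorm_def real_sqrt_mult)
  moreover have pos: "lnorm x * lnorm y > 0"
    using px py by (simp add: lnorm_def)
  ultimately have le: "\<bar>lorentz x y / (lnorm x * lnorm y)\<bar> \<le> 1"
    by (simp only: abs_divide abs_of_pos divide_le_eq_1_pos)
  let ?P = "\<lambda>\<theta>. \<theta> \<in> {0..pi} \<and> lorentz x y = lnorm x * lnorm y * cos \<theta>"
  have "?P (arccos (lorentz x y / (lnorm x * lnorm y)))"
  proof -
    let ?q = "lorentz x y / (lnorm x * lnorm y)"
    have "-1 \<le> ?q" "?q \<le> 1"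
      using le by linarith+
    then have "arccos ?q \<in> {0..pi}"
      by (simp only: atLeastAtMost_iff arccos_lbound arccos_ubound)
    moreover have "lorentz x y = lnorm x * lnorm y * cos (arccos ?q)"
      using pos by (simp only: cos_arccos_abs[OF le]) auto
    ultimately show ?thesis by blast
  qed
  then obtain \<phi> where \<phi>: "?P \<phi>" by blast
  moreover have "\<theta> = \<phi>" if "?P \<theta>" for \<theta>
  proof -
    have "lnorm x * lnorm y * cos \<theta> = lnorm x * lnorm y * cos \<phi>"
      using that \<phi> by linarith
    then have "cos \<theta> = cos \<phi>"
      using pos by (simp only: mult_cancel_left) auto
    then show ?thesis
      using that \<phi> cos_inj_pi[of \<theta> \<phi>] by (simp only: atLeastAtMost_iff)
  qed
  ultimately have "spacelike_angle x y = \<phi>"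
    unfolding spacelike_angle_def by (intro the_equality)
  with \<phi> have "?P (spacelike_angle x y)" by simp
  then show "spacelike_angle x y \<in> {0..pi}"
    "lorentz x y = lnorm x * lnorm y * cos (spacelike_angle x y)" by auto
qed

text \<open>
  Derivatives along an interval \<open>J\<close>, open or not; they are one-sided at an end point of \<open>J\<close> that
  belongs to \<open>J\<close>.
\<close>

definition D :: "real set \<Rightarrow> (real \<Rightarrow> 'a::real_normed_vector) \<Rightarrow> real \<Rightarrow> 'a" where
  "D J f u = vector_derivative f (at u within J)"

definition nondegenerate_interval :: "real set \<Rightarrow> bool" where
  "nondegenerate_interval J \<longleftrightarrow> is_interval J \<and> interior J \<noteq> {}"

definition smooth_on :: "real set \<Rightarrow> (real \<Rightarrow> 'a::real_normed_vector) \<Rightarrow> bool" where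
  "smooth_on J f \<longleftrightarrow> (\<forall>k. \<forall>u\<in>J. (D J ^^ k) f differentiable (at u within J))"

text \<open>A surface \<open>X u v\<close> has parameter domain \<open>J \<times> \<real>\<close>.\<close>

definition X_u :: "real set \<Rightarrow> (real \<Rightarrow> real \<Rightarrow> 'a::real_normed_vector) \<Rightarrow> real \<Rightarrow> real \<Rightarrow> 'a" where
  "X_u J X u v = D J (\<lambda>s. X s v) u"

definition X_v :: "(real \<Rightarrow> real \<Rightarrow> 'a::real_normed_vector) \<Rightarrow> real \<Rightarrow> real \<Rightarrow> 'a" where
  "X_v X u v = D UNIV (\<lambda>t. X u t) v"

definition spacelike_surface ::
  "real set \<Rightarrow> (real \<Rightarrow> real \<Rightarrow> real ^ 'n::{finite,linorder}) \<Rightarrow> bool" where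
  "spacelike_surface J X \<longleftrightarrow> (\<forall>u\<in>J. \<forall>v.
     lorentz (X_u J X u v) (X_u J X u v) * lorentz (X_v X u v) (X_v X u v)
       - (lorentz (X_u J X u v) (X_v X u v))\<^sup>2 > 0)"

text \<open>
  In the profile curves below, \<open>x i\<close> is the coordinate function \<open>x\<^sub>i\<close>.  The function \<open>x 2\<close>
  (types I and III) resp. \<open>x (n - 1)\<close> (type II) is not used.
\<close>

definition beta_I :: "(nat \<Rightarrow> real \<Rightarrow> real) \<Rightarrow> real \<Rightarrow> real ^ 'n::{finite,linorder}" where
  "beta_I x u = x 1 u *\<^sub>R e 1 + (\<Sum>i = 3..CARD('n). x i u *\<^sub>R e i)"

definition surface_I ::
  "real \<Rightarrow> (nat \<Rightarrow> real \<Rightarrow> real) \<Rightarrow> real \<Rightarrow> real \<Rightarrow> real ^ 'n::{finite,linorder}" where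
  "surface_I c x u v =
     (x 1 u * cos v) *\<^sub>R e 1 + (x 1 u * sin v) *\<^sub>R e 2
     + (\<Sum>i = 3..CARD('n) - 1. x i u *\<^sub>R e i)
     + (x CARD('n) u + c * v) *\<^sub>R e CARD('n)"

definition beta_II :: "(nat \<Rightarrow> real \<Rightarrow> real) \<Rightarrow> real \<Rightarrow> real ^ 'n::{finite,linorder}" where
  "beta_II x u = (\<Sum>i = 1..CARD('n) - 2. x i u *\<^sub>R e i) + x CARD('n) u *\<^sub>R e CARD('n)"

definition surface_II ::
  "real \<Rightarrow> (nat \<Rightarrow> real \<Rightarrow> real) \<Rightarrow> real \<Rightarrow> real \<Rightarrow> real ^ 'n::{finite,linorder}" where
  "surface_II c x u v =
     (x 1 u + c * v) *\<^sub>R e 1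
     + (\<Sum>i = 2..CARD('n) - 2. x i u *\<^sub>R e i)
     + (x CARD('n) u * sinh v) *\<^sub>R e (CARD('n) - 1)
     + (x CARD('n) u * cosh v) *\<^sub>R e CARD('n)"

definition beta_III :: "(nat \<Rightarrow> real \<Rightarrow> real) \<Rightarrow> real \<Rightarrow> real ^ 'n::{finite,linorder}" where
  "beta_III x u =
     x 1 u *\<^sub>R e 1 + (\<Sum>i = 3..CARD('n) - 2. x i u *\<^sub>R e i)
     + x (CARD('n) - 1) u *\<^sub>R xi_pred + x CARD('n) u *\<^sub>R xi_last"

definition surface_III ::
  "real \<Rightarrow> (nat \<Rightarrow> real \<Rightarrow> real) \<Rightarrow> real \<Rightarrow> real \<Rightarrow> real ^ 'n::{finite,linorder}" where
  "surface_III c x u v =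
     x 1 u *\<^sub>R e 1 + (sqrt 2 * v * x CARD('n) u) *\<^sub>R e 2
     + (\<Sum>i = 3..CARD('n) - 2. x i u *\<^sub>R e i)
     + (x (CARD('n) - 1) u + v\<^sup>2 * x CARD('n) u + c * v) *\<^sub>R xi_pred
     + x CARD('n) u *\<^sub>R xi_last"

text \<open>
  \<open>X\<close> is the helicoidal surface of the given type with translation constant \<open>c\<close> and profile
  coordinates \<open>x\<close>, the profile having arc length parameter in \<open>J\<close> and causal character \<open>\<epsilon>\<close>.
  The \<open>span\<close> condition says that the translation axis does not meet the profile.
\<close>

definition helicoidal_I ::
  "real set \<Rightarrow> real \<Rightarrow> real \<Rightarrow> (nat \<Rightarrow> real \<Rightarrow> real)
     \<Rightarrow> (real \<Rightarrow> real \<Rightarrow> real ^ 'n::{finite,linorder}) \<Rightarrow> bool" where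
  "helicoidal_I J \<epsilon> c x X \<longleftrightarrow>
     CARD('n) \<ge> 3 \<and> c > 0 \<and> \<epsilon> \<in> {1, -1} \<and> nondegenerate_interval J
     \<and> smooth_on J (beta_I x :: real \<Rightarrow> real ^ 'n::{finite,linorder})
     \<and> (\<forall>u\<in>J. (beta_I x u :: real ^ 'n::{finite,linorder}) \<notin> span {e CARD('n)})
     \<and> (\<forall>u\<in>J. (D J (x 1) u)\<^sup>2 + (\<Sum>i = 3..CARD('n) - 1. (D J (x i) u)\<^sup>2)
                - (D J (x CARD('n)) u)\<^sup>2 = \<epsilon>)
     \<and> (\<forall>u\<in>J. \<forall>v. X u v = surface_I c x u v)"

definition helicoidal_II ::
  "real set \<Rightarrow> real \<Rightarrow> real \<Rightarrow> (nat \<Rightarrow> real \<Rightarrow> real)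
     \<Rightarrow> (real \<Rightarrow> real \<Rightarrow> real ^ 'n::{finite,linorder}) \<Rightarrow> bool" where
  "helicoidal_II J \<epsilon> c x X \<longleftrightarrow>
     CARD('n) \<ge> 3 \<and> c > 0 \<and> \<epsilon> \<in> {1, -1} \<and> nondegenerate_interval J
     \<and> smooth_on J (beta_II x :: real \<Rightarrow> real ^ 'n::{finite,linorder})
     \<and> (\<forall>u\<in>J. (beta_II x u :: real ^ 'n::{finite,linorder}) \<notin> span {e 1})
     \<and> (\<forall>u\<in>J. (\<Sum>i = 1..CARD('n) - 2. (D J (x i) u)\<^sup>2) - (D J (x CARD('n)) u)\<^sup>2 = \<epsilon>)
     \<and> (\<forall>u\<in>J. \<forall>v. X u v = surface_II c x u v)"

definition helicoidal_III ::
  "real set \<Rightarrow> real \<Rightarrow> real \<Rightarrow> (nat \<Rightarrow> real \<Rightarrow> real)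
     \<Rightarrow> (real \<Rightarrow> real \<Rightarrow> real ^ 'n::{finite,linorder}) \<Rightarrow> bool" where
  "helicoidal_III J \<epsilon> c x X \<longleftrightarrow>
     CARD('n) \<ge> 4 \<and> c > 0 \<and> \<epsilon> \<in> {1, -1} \<and> nondegenerate_interval J
     \<and> smooth_on J (beta_III x :: real \<Rightarrow> real ^ 'n::{finite,linorder})
     \<and> (\<forall>u\<in>J. (beta_III x u :: real ^ 'n::{finite,linorder}) \<notin> span {xi_pred})
     \<and> (\<forall>u\<in>J. (D J (x 1) u)\<^sup>2 + (\<Sum>i = 3..CARD('n) - 2. (D J (x i) u)\<^sup>2)
                - 2 * D J (x (CARD('n) - 1)) u * D J (x CARD('n)) u = \<epsilon>)
     \<and> (\<forall>u\<in>J. \<forall>v. X u v = surface_III c x u v)"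

text \<open>\<open>\<alpha>\<close> is the curve \<open>u \<mapsto> X u (v u)\<close>, with angle \<open>\<theta>\<^sub>0\<close> to the meridians of \<open>X\<close>.\<close>

definition spacelike_loxodrome ::
  "real set \<Rightarrow> (real \<Rightarrow> real \<Rightarrow> real ^ 'n::{finite,linorder}) \<Rightarrow> (real \<Rightarrow> real) \<Rightarrow> real
     \<Rightarrow> (real \<Rightarrow> real ^ 'n::{finite,linorder}) \<Rightarrow> bool" where
  "spacelike_loxodrome J X v \<theta>\<^sub>0 \<alpha> \<longleftrightarrow>
     smooth_on J v \<and> (\<forall>u\<in>J. \<alpha> u = X u (v u))
     \<and> (\<forall>u\<in>J. spacelike (D J \<alpha> u))
     \<and> (\<forall>u\<in>J. spacelike (X_u J X u (v u))
          \<and> spacelike_subspace (span {D J \<alpha> u, X_u J X u (v u)})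
          \<and> spacelike_angle (D J \<alpha> u) (X_u J X u (v u)) = \<theta>\<^sub>0)"

end

theory Submission
  imports Defs
begin

text \<open>
  Let \<open>a\<close> and \<open>b\<close> be the partial derivatives of the surface with respect to \<open>u\<close> and \<open>v\<close>, so that
  \<open>\<langle>a, a\<rangle> = 1\<close> and the tangent of the loxodrome is \<open>a + v' b\<close>.  With \<open>F = \<langle>a, b\<rangle>\<close> and \<open>G = \<langle>b, b\<rangle>\<close>,
  squaring the angle condition gives
  \<open>(1 + v' F)\<^sup>2 = cos\<^sup>2 \<theta> (1 + 2 v' F + v'\<^sup>2 G)\<close>, and completing the square turns this into
  \<open>(2 (cos\<^sup>2 \<theta> G - F\<^sup>2) v' - 2 F sin\<^sup>2 \<theta>)\<^sup>2 = sin\<^sup>2 2\<theta> (G - F\<^sup>2)\<close>.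
  The right-hand side is either identically zero or, the surface being spacelike, everywhere
  positive; so the continuous function squared on the left has a constant sign on the interval.
  Solving for \<open>v'\<close> and integrating gives the formula.  On all three types \<open>F\<close> and \<open>G\<close> depend on
  \<open>u\<close> only: \<open>F\<close> is \<open>-c x\<^sub>n'\<close>, \<open>c x\<^sub>1'\<close>, \<open>-c x\<^sub>n'\<close> and \<open>G\<close> is \<open>x\<^sub>1\<^sup>2 - c\<^sup>2\<close>, \<open>c\<^sup>2 + x\<^sub>n\<^sup>2\<close>, \<open>2 x\<^sub>n\<^sup>2\<close>.
\<close>

section \<open>Continuous square roots on a connected set\<close>

text \<open>If \<open>g\<close> took both signs, the intermediate value theorem would give it a
  zero, hence a zero of \<open>h\<close>; by the dichotomy \<open>h\<close>, and so
  \<open>g\<close>, would then vanish identically. The dichotomy matters: \<open>g u = u\<close>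
  with \<open>h u = u^2\<close> changes sign at its zero.\<close>

lemma continuous_square_root_sign:
  fixes g h :: "real \<Rightarrow> real"
  assumes "connected J" "continuous_on J g"
    and sq: "\<And>u. u \<in> J \<Longrightarrow> (g u)\<^sup>2 = h u"
    and h: "(\<forall>u\<in>J. h u > 0) \<or> (\<forall>u\<in>J. h u = 0)"
  shows "\<exists>s\<in>{1, -1::real}. \<forall>u\<in>J. g u = s * sqrt (h u)"
proof -
  have abs: "\<bar>g u\<bar> = sqrt (h u)" if "u \<in> J" for u
    using sq[OF that] real_sqrt_abs[of "g u"] by simp
  consider "\<forall>u\<in>J. 0 \<le> g u" | "\<forall>u\<in>J. g u \<le> 0"
  proof (cases "\<forall>u\<in>J. h u = 0")
    case True
    then show ?thesis using sq that by (metis order_refl zero_eq_power2)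
  next
    case False
    then have nz: "g u \<noteq> 0" if "u \<in> J" for u
      using h sq[OF that] that by force
    have "connected (g ` J)"
      using assms by (intro connected_continuous_image)
    then have "is_interval (g ` J)"
      by (simp add: is_interval_connected_1)
    then have "0 \<in> g ` J" if "a \<in> J" "b \<in> J" "g a \<le> 0" "0 \<le> g b" for a b
      using mem_is_interval_1_I[of "g ` J" "g a" "g b" 0] that by blast
    then have "\<not> (g a \<le> 0 \<and> 0 \<le> g b)" if "a \<in> J" "b \<in> J" for a b
      using that nz by fastforce
    then show ?thesis using that by (meson linear)
  qed
  then show ?thesis
  proof cases
    case 1
    then show ?thesis by (intro bexI[of _ 1]) (auto simp flip: abs)
  next
    case 2
    then show ?thesis by (intro bexI[of _ "-1"]) (auto simp flip: abs)
  qed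
qed

section \<open>Derivatives along an interval\<close>

text \<open>A connected set with a second point has no isolated points. This makes derivatives
  within \<open>J\<close> unique, also at an end point.\<close>

lemma at_within_nondegenerate_interval:
  assumes "nondegenerate_interval J" "u \<in> J"
  shows "at u within J \<noteq> bot"
proof -
  \<comment> \<open>The interior is open and a singleton is not, so a nonempty interior supplies a
    point other than \<open>u\<close>.\<close>
  have "interior J \<noteq> {u}"
    using not_open_singleton[of u] open_interior[of J] by metis
  moreover have "interior J \<noteq> {}"
    using assms by (simp add: nondegenerate_interval_def)
  ultimately obtain a where a: "a \<in> interior J" "a \<noteq> u" by blast
  have "connected J" using assms by (simp add: nondegenerate_interval_def is_interval_connected)
  moreover have "a \<in> J" using a interior_subset by blast
  ultimately have "u islimpt J"
    using a assms connected_imp_perfect[of J u] by blast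
  then show ?thesis by (simp add: trivial_limit_within)
qed

lemma D_eqI:
  assumes "nondegenerate_interval J" "u \<in> J" "(f has_vector_derivative d) (at u within J)"
  shows "D J f u = d"
  unfolding D_def
  using assms at_within_nondegenerate_interval by (blast intro: vector_derivative_within)

lemma smooth_on_D:
  assumes "smooth_on J f" "u \<in> J"
  shows "(f has_vector_derivative D J f u) (at u within J)"
proof -
  have "(D J ^^ 0) f differentiable (at u within J)"
    using assms unfolding smooth_on_def by blast
  then show ?thesis
    by (simp add: D_def vector_derivative_works)
qed

lemma smooth_on_continuous_on_D:
  assumes "smooth_on J f"
  shows "continuous_on J (D J f)"
proof -
  have "\<forall>u\<in>J. (D J ^^ 1) f differentiable (at u within J)"
    using assms unfolding smooth_on_def by blast
  then show ?thesis
    by (simp add: continuous_on_eq_continuous_within differentiable_imp_continuous_within)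
qed

section \<open>Bilinearity of the Lorentz product\<close>

lemma lorentz_add_right: "lorentz x (y + z) = lorentz x y + lorentz x z"
  by (simp add: lorentz_commute[of x] lorentz_add_left)

lemma lorentz_scaleR_right: "lorentz x (a *\<^sub>R y) = a * lorentz x y"
  by (simp add: lorentz_commute[of x] lorentz_scaleR_left)

lemma lorentz_zero_right: "lorentz z 0 = 0"
  by (simp add: lorentz_commute[of z] lorentz_zero)

text \<open>Linear maps on a finite-dimensional space are bounded. Boundedness is what lets
  derivatives and continuity pass through the product.\<close>

lemma bounded_linear_lorentz: "bounded_linear (\<lambda>y. lorentz y z)"
  by (intro linear_conv_bounded_linear[THEN iffD1] linearI)
    (simp_all add: lorentz_add_left lorentz_scaleR_left)

lemma lorentz_sum_left: "lorentz (\<Sum>i\<in>S. f i) z = (\<Sum>i\<in>S. lorentz (f i) z)"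
  by (rule linear_sum[OF bounded_linear.linear[OF bounded_linear_lorentz]])

lemma lorentz_diff_left: "lorentz (x - y) z = lorentz x z - lorentz y z"
  by (rule linear_diff[OF bounded_linear.linear[OF bounded_linear_lorentz]])

lemma lorentz_diff_right: "lorentz z (x - y) = lorentz z x - lorentz z y"
  by (simp add: lorentz_commute[of z] lorentz_diff_left)

lemma lorentz_minus_right: "lorentz x (- y) = - lorentz x y"
  using lorentz_scaleR_right[of x "-1" y] by simp

lemmas lorentz_bilinear = lorentz_minus_right lorentz_add_left lorentz_add_right lorentz_scaleR_left
  lorentz_scaleR_right lorentz_diff_left lorentz_diff_right lorentz_zero lorentz_zero_right

section \<open>Products in the standard frame and in the null frame\<close>

text \<open>Distinct indices name distinct coordinates because \<open>ix\<close> is injective on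
  \<open>{1..n}\<close>. The range is essential: truncated subtraction gives
  \<open>ix 0 = ix 1\<close>.\<close>

lemma e_nth:
  assumes "i \<in> {1..CARD('n)}" "j \<in> {1..CARD('n)}"
  shows "(e i :: real ^ 'n::{finite,linorder}) $ ix j = (if i = j then 1 else 0)"
  using inj_onD[OF bij_betw_imp_inj_on[OF bij_betw_ix[where 'n='n]], of i j] assms
  by (auto simp: e_def axis_def)

lemma lorentz_e:
  assumes "i \<in> {1..CARD('n)}" "j \<in> {1..CARD('n)}"
  shows "lorentz (e i :: real ^ 'n::{finite,linorder}) (e j)
    = (if i = j then if i = CARD('n) then -1 else 1 else 0)"
proof -
  have "(\<Sum>k = 1..CARD('n) - 1. (e i :: (real, 'n) vec) $ ix k * (e j :: (real, 'n) vec) $ ix k)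
      = (\<Sum>k = 1..CARD('n) - 1. if k = i then if i = j then 1 else 0 else 0)"
    using assms by (intro sum.cong refl) (auto simp: e_nth)
  moreover have "CARD('n) \<in> {1..CARD('n)}" using assms by auto
  ultimately show ?thesis
    using assms by (auto simp: lorentz_def e_nth)
qed

lemma lorentz_sum_e:
  assumes "S \<subseteq> {1..CARD('n)}" "j \<in> {1..CARD('n)}"
  shows "lorentz (\<Sum>i\<in>S. f i *\<^sub>R e i :: real ^ 'n::{finite,linorder}) (e j)
    = (if j \<in> S then if j = CARD('n) then - f j else f j else 0)"
proof -
  have "lorentz (\<Sum>i\<in>S. f i *\<^sub>R e i :: (real, 'n) vec) (e j)
    = (\<Sum>i\<in>S. if i = j then if j = CARD('n) then - f j else f j else 0)"
    unfolding lorentz_sum_left lorentz_scaleR_left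
    using assms by (intro sum.cong refl) (auto simp: lorentz_e)
  moreover have "finite S" using assms finite_subset by blast
  ultimately show ?thesis by simp
qed

lemma lorentz_e_sum:
  assumes "S \<subseteq> {1..CARD('n)}" "j \<in> {1..CARD('n)}"
  shows "lorentz (e j) (\<Sum>i\<in>S. f i *\<^sub>R e i :: real ^ 'n::{finite,linorder})
    = (if j \<in> S then if j = CARD('n) then - f j else f j else 0)"
  using lorentz_sum_e[OF assms] by (simp add: lorentz_commute)

text \<open>Excluding the time index leaves only vectors \<open>e i\<close> of square
  \<open>1\<close>, so this is the Euclidean Pythagorean identity.\<close>

lemma lorentz_sum_sum:
  assumes "S \<subseteq> {1..CARD('n)}" "CARD('n) \<notin> S"
  shows "lorentz (\<Sum>i\<in>S. f i *\<^sub>R e i :: real ^ 'n::{finite,linorder}) (\<Sum>i\<in>S. f i *\<^sub>R e i)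
    = (\<Sum>i\<in>S. (f i)\<^sup>2)"
proof -
  have "lorentz (e j) (\<Sum>i\<in>S. f i *\<^sub>R e i :: (real, 'n) vec) = f j" if "j \<in> S" for j
    using lorentz_e_sum[OF assms(1), of j f] assms that by auto
  then show ?thesis
    unfolding lorentz_sum_left[of "\<lambda>i. f i *\<^sub>R e i"] lorentz_scaleR_left
    by (simp add: power2_eq_square)
qed

lemmas lorentz_frame = lorentz_e lorentz_sum_e lorentz_e_sum lorentz_sum_sum

text \<open>The two null vectors involve only \<open>e (n - 1)\<close> and \<open>e n\<close>, which
  are orthogonal to every earlier frame vector. Both argument orders are recorded so that all cases
  can be used as rewrite rules.\<close>

lemma lorentz_xi_e:
  assumes "CARD('n) \<ge> 2" "j \<in> {1..CARD('n) - 2}"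
  shows "lorentz xi_pred (e j :: real ^ 'n::{finite,linorder}) = 0"
    and "lorentz xi_last (e j :: (real, 'n) vec) = 0"
    and "lorentz (e j :: (real, 'n) vec) xi_pred = 0"
    and "lorentz (e j :: (real, 'n) vec) xi_last = 0"
  using assms by (auto simp: xi_pred_def xi_last_def lorentz_bilinear lorentz_e)

lemma lorentz_xi_sum:
  assumes "CARD('n) \<ge> 2" "S \<subseteq> {1..CARD('n) - 2}"
  shows "lorentz xi_pred (\<Sum>i\<in>S. f i *\<^sub>R e i :: real ^ 'n::{finite,linorder}) = 0"
    and "lorentz xi_last (\<Sum>i\<in>S. f i *\<^sub>R e i :: (real, 'n) vec) = 0"
    and "lorentz (\<Sum>i\<in>S. f i *\<^sub>R e i :: (real, 'n) vec) xi_pred = 0"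
    and "lorentz (\<Sum>i\<in>S. f i *\<^sub>R e i :: (real, 'n) vec) xi_last = 0"
proof -
  show "lorentz (\<Sum>i\<in>S. f i *\<^sub>R e i :: (real, 'n) vec) xi_pred = 0"
    "lorentz (\<Sum>i\<in>S. f i *\<^sub>R e i :: (real, 'n) vec) xi_last = 0"
    unfolding lorentz_sum_left lorentz_scaleR_left
    using assms lorentz_xi_e[where 'n='n] by (auto intro!: sum.neutral)
  then show "lorentz xi_pred (\<Sum>i\<in>S. f i *\<^sub>R e i :: (real, 'n) vec) = 0"
    "lorentz xi_last (\<Sum>i\<in>S. f i *\<^sub>R e i :: (real, 'n) vec) = 0"
    by (simp_all add: lorentz_commute)
qed

lemma lorentz_xi_xi:
  assumes "CARD('n) \<ge> 2"
  shows "lorentz xi_pred (xi_pred :: real ^ 'n::{finite,linorder}) = 0"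
    and "lorentz xi_last (xi_last :: (real, 'n) vec) = 0"
    and "lorentz xi_pred (xi_last :: (real, 'n) vec) = -1"
    and "lorentz xi_last (xi_pred :: (real, 'n) vec) = -1"
  using assms by (auto simp: xi_pred_def xi_last_def lorentz_bilinear lorentz_e)

lemmas lorentz_null_frame = lorentz_xi_e lorentz_xi_sum lorentz_xi_xi

section \<open>Regularity of the profile coordinates\<close>

text \<open>Smoothness is assumed of the profile curve as a vector-valued function. A coordinate
  obtained as the product with a fixed vector \<open>z\<close> is a bounded linear image of the
  curve and inherits its regularity.\<close>

lemma smooth_on_lorentz_coordinate:
  fixes f :: "real \<Rightarrow> real ^ 'n::{finite,linorder}"
  assumes J: "nondegenerate_interval J" and f: "smooth_on J f"
    and g: "\<And>u. g u = lorentz (f u) z"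
  shows "u \<in> J \<Longrightarrow> (g has_real_derivative D J g u) (at u within J)"
    and "continuous_on J (D J g)" and "continuous_on J g"
proof -
  let ?L = "\<lambda>y. lorentz y z"
  note L = bounded_linear_lorentz[of z]
  have *: "(g has_vector_derivative ?L (D J f u)) (at u within J)" if "u \<in> J" for u
    unfolding g[abs_def] by (rule bounded_linear.has_vector_derivative[OF L smooth_on_D[OF f that]])
  have D: "D J g u = ?L (D J f u)" if "u \<in> J" for u
    using D_eqI[OF J that *[OF that]] .
  show "u \<in> J \<Longrightarrow> (g has_real_derivative D J g u) (at u within J)"
    using * D by (simp add: has_real_derivative_iff_has_vector_derivative)
  have "continuous_on J (\<lambda>u. ?L (D J f u))"
    using bounded_linear.continuous_on[OF L smooth_on_continuous_on_D[OF f]] .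
  then show "continuous_on J (D J g)"
    by (simp add: D cong: continuous_on_cong)
  show "continuous_on J g"
    using * by (meson continuous_on_eq_continuous_within has_vector_derivative_continuous)
qed

section \<open>The quadratic equation for the slope of a loxodrome\<close>

text \<open>Since \<open>a\<close> has norm \<open>1\<close>, the angle formula expresses the
  product of the tangent with \<open>a\<close> as the norm of the tangent times
  \<open>cos \<theta>\<close>; squaring removes the root in that norm.\<close>

lemma spacelike_angle_with_meridian:
  assumes a: "lorentz a a = 1"
    and nd: "lorentz a a * lorentz b b - (lorentz a b)\<^sup>2 > 0"
    and sp: "spacelike (a + w *\<^sub>R b)" "spacelike a"
      "spacelike_subspace (span {a + w *\<^sub>R b, a})"
    and \<theta>: "spacelike_angle (a + w *\<^sub>R b) a = \<theta>"
  shows "(1 + w * lorentz a b)\<^sup>2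
    = (cos \<theta>)\<^sup>2 * (1 + 2 * w * lorentz a b + w\<^sup>2 * lorentz b b)"
proof -
  let ?t = "a + w *\<^sub>R b"
  \<comment> \<open>The angle formula is available for nonzero vectors only. A vanishing tangent
    would make \<open>a\<close> and \<open>b\<close> linearly dependent, against the positive Gram
    determinant.\<close>
  have "?t \<noteq> 0"
  proof
    assume "?t = 0"
    then have "lorentz ?t a = 0" "lorentz ?t b = 0" by (simp_all add: lorentz_zero)
    then have "1 + w * lorentz a b = 0" "lorentz a b + w * lorentz b b = 0"
      using a by (simp_all add: lorentz_add_left lorentz_scaleR_left lorentz_commute[of b a])
    \<comment> \<open>With \<open>F = lorentz a b\<close> and \<open>G = lorentz b b\<close>,
      substituting \<open>F = - w * G\<close> into one factor of \<open>F^2\<close> gives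
      \<open>G - F^2 = G * (1 + w * F) = 0\<close>.\<close>
    then have "lorentz b b - (lorentz a b)\<^sup>2 = 0" by algebra
    then show False using nd a by simp
  qed
  moreover have "a \<noteq> 0" using a lorentz_zero[of a] by auto
  ultimately have ang: "lorentz ?t a = lnorm ?t * lnorm a * cos \<theta>"
    using spacelike_angle(2)[OF sp(1,2)] sp(3) \<theta> by blast
  have tt: "lorentz ?t ?t = 1 + 2 * w * lorentz a b + w\<^sup>2 * lorentz b b"
    using a by (simp add: lorentz_add_left lorentz_scaleR_left lorentz_add_right
      lorentz_scaleR_right lorentz_commute[of b a] power2_eq_square algebra_simps)
  have "lorentz ?t ?t \<ge> 0"
    using sp(1) lorentz_zero unfolding spacelike_def by (metis less_imp_le order_refl)
  then have "(lnorm ?t)\<^sup>2 = lorentz ?t ?t" by (simp add: lnorm_def)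
  moreover have "lnorm a = 1" using a by (simp add: lnorm_def)
  moreover have "lorentz ?t a = 1 + w * lorentz a b"
    using a by (simp add: lorentz_add_left lorentz_scaleR_left lorentz_commute[of b a])
  ultimately have "(1 + w * lorentz a b)\<^sup>2 = lorentz ?t ?t * (cos \<theta>)\<^sup>2"
    using ang by (metis mult.right_neutral power_mult_distrib)
  then show ?thesis using tt by (simp add: mult.commute)
qed

text \<open>Put \<open>C = cos^2 \<theta>\<close>, \<open>S = sin^2 \<theta>\<close> and
  \<open>P = C * G - F^2\<close>. The hypothesis reads
  \<open>P * w^2 - 2 * F * S * w - S = 0\<close>. Multiplying by \<open>4 * P\<close> and completing
  the square leaves \<open>4 * S * (P + F^2 * S) = 4 * S * C * (G - F^2)\<close> on the right.
  Nothing is divided by \<open>P\<close>.\<close>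

lemma loxodrome_discriminant:
  fixes w F G \<theta> :: real
  assumes "(1 + w * F)\<^sup>2 = (cos \<theta>)\<^sup>2 * (1 + 2 * w * F + w\<^sup>2 * G)"
  shows "(2 * ((cos \<theta>)\<^sup>2 * G - F\<^sup>2) * w - 2 * F * (sin \<theta>)\<^sup>2)\<^sup>2
    = (sin (2 * \<theta>))\<^sup>2 * (G - F\<^sup>2)"
  using assms sin_cos_squared_add[of \<theta>] unfolding sin_double by algebra

text \<open>The sign is chosen before \<open>u\<close>: one branch of the square root serves the
  whole interval, and the fundamental theorem of calculus then recovers \<open>v\<close> from its
  derivative.\<close>

lemma loxodrome_integral:
  fixes v F G :: "real \<Rightarrow> real" and \<theta> :: real
  assumes J: "nondegenerate_interval J" and v: "smooth_on J v"
    and F: "continuous_on J F" and G: "continuous_on J G"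
    and pos: "\<And>u. u \<in> J \<Longrightarrow> G u - (F u)\<^sup>2 > 0"
    and eq: "\<And>u. u \<in> J \<Longrightarrow> (1 + D J v u * F u)\<^sup>2
      = (cos \<theta>)\<^sup>2 * (1 + 2 * D J v u * F u + (D J v u)\<^sup>2 * G u)"
    and nz: "\<And>u. u \<in> J \<Longrightarrow> (cos \<theta>)\<^sup>2 * G u - (F u)\<^sup>2 \<noteq> 0"
    and u0: "u\<^sub>0 \<in> J" "v u\<^sub>0 = 0"
  shows "\<exists>s\<in>{1, -1::real}. \<forall>u\<in>J. v u = (LBINT \<xi>=ereal u\<^sub>0..ereal u.
    (2 * F \<xi> * (sin \<theta>)\<^sup>2 + s * sqrt ((sin (2 * \<theta>))\<^sup>2 * (G \<xi> - (F \<xi>)\<^sup>2)))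
      / (2 * ((cos \<theta>)\<^sup>2 * G \<xi> - (F \<xi>)\<^sup>2)))"
proof -
  let ?g = "\<lambda>u. 2 * ((cos \<theta>)\<^sup>2 * G u - (F u)\<^sup>2) * D J v u - 2 * F u * (sin \<theta>)\<^sup>2"
  let ?h = "\<lambda>u. (sin (2 * \<theta>))\<^sup>2 * (G u - (F u)\<^sup>2)"
  note Dv = smooth_on_continuous_on_D[OF v]
  have iv: "is_interval J" using J by (simp add: nondegenerate_interval_def)
  have "\<exists>s\<in>{1, -1::real}. \<forall>u\<in>J. ?g u = s * sqrt (?h u)"
  proof (rule continuous_square_root_sign)
    show "connected J" using iv by (rule is_interval_connected)
    show "continuous_on J ?g" by (intro continuous_intros F G Dv)
    show "(?g u)\<^sup>2 = ?h u" if "u \<in> J" for u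
      using loxodrome_discriminant[OF eq[OF that]] .
    show "(\<forall>u\<in>J. ?h u > 0) \<or> (\<forall>u\<in>J. ?h u = 0)"
      using pos by (cases "sin (2 * \<theta>) = 0") auto
  qed
  then obtain s where s: "s \<in> {1, -1::real}" and g: "\<And>u. u \<in> J \<Longrightarrow> ?g u = s * sqrt (?h u)"
    by blast
  let ?f = "\<lambda>\<xi>. (2 * F \<xi> * (sin \<theta>)\<^sup>2 + s * sqrt (?h \<xi>)) / (2 * ((cos \<theta>)\<^sup>2 * G \<xi> - (F \<xi>)\<^sup>2))"
  \<comment> \<open>By the choice of \<open>s\<close> the numerator equals the denominator times
    \<open>D J v u\<close>, and the denominator is nonzero by \<open>nz\<close>.\<close>
  have f: "?f u = D J v u" if "u \<in> J" for u
    unfolding g[OF that, symmetric] using nz[OF that] by simp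
  have "v u = (LBINT \<xi>=ereal u\<^sub>0..ereal u. ?f \<xi>)" if "u \<in> J" for u
  proof -
    \<comment> \<open>\<open>u\<close> may lie on either side of \<open>u\<^sub>0\<close>, so the
      segment between them is written with \<open>min\<close> and \<open>max\<close>.\<close>
    let ?I = "{min u\<^sub>0 u..max u\<^sub>0 u}"
    have I: "?I \<subseteq> J"
    proof
      have "min u\<^sub>0 u \<in> J" "max u\<^sub>0 u \<in> J"
        using that u0 by (simp_all add: min_def max_def)
      then show "t \<in> J" if "t \<in> ?I" for t
        using mem_is_interval_1_I[OF iv] that by (meson atLeastAtMost_iff)
    qed
    have "(LBINT \<xi>=ereal u\<^sub>0..ereal u. ?f \<xi>) = v u - v u\<^sub>0"
    proof (rule interval_integral_FTC_finite)
      \<comment> \<open>The integrand is continuous because it agrees on \<open>J\<close> with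
        \<open>D J v\<close>; neither the root nor the quotient has to be examined.\<close>
      have "continuous_on J ?f" using Dv by (simp only: f cong: continuous_on_cong)
      then show "continuous_on ?I ?f" using I continuous_on_subset by blast
      show "(v has_vector_derivative ?f t) (at t within ?I)"
        if "min u\<^sub>0 u \<le> t" "t \<le> max u\<^sub>0 u" for t
      proof -
        have "t \<in> J" using that I by auto
        then show ?thesis
          using smooth_on_D[OF v] f I by (metis has_vector_derivative_within_subset)
      qed
    qed
    then show ?thesis using u0 by simp
  qed
  with s show ?thesis by blast
qed

section \<open>From partial derivatives to the parametrization\<close>

text \<open>The argument shared by the three types. \<open>A\<close> and \<open>B\<close> are the
  partial derivatives of \<open>S\<close>, and \<open>dS\<close> is the chain rule along a curve
  \<open>s \<mapsto> S s (w s)\<close>. The functions \<open>N\<close>, \<open>H\<close> and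
  \<open>Q\<close> allow each type to state numerator, radicand and denominator in its own
  shape.\<close>

lemma loxodrome_parametrization:
  fixes X S :: "real \<Rightarrow> real \<Rightarrow> real ^ 'n::{finite,linorder}"
  assumes surf: "spacelike_surface J X" and lox: "spacelike_loxodrome J X v \<theta> \<alpha>"
    and u0: "u\<^sub>0 \<in> J" "v u\<^sub>0 = 0" and J: "nondegenerate_interval J"
    and X: "\<And>u t. u \<in> J \<Longrightarrow> X u t = S u t"
    and dS: "\<And>u w w'. u \<in> J \<Longrightarrow> (w has_real_derivative w') (at u within J) \<Longrightarrow>
      ((\<lambda>s. S s (w s)) has_vector_derivative A u (w u) + w' *\<^sub>R B u (w u)) (at u within J)"
    and dS': "\<And>u t. u \<in> J \<Longrightarrow> (S u has_vector_derivative B u t) (at t)"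
    and AA: "\<And>u t. u \<in> J \<Longrightarrow> lorentz (A u t) (A u t) = 1"
    and AB: "\<And>u t. u \<in> J \<Longrightarrow> lorentz (A u t) (B u t) = F u"
    and BB: "\<And>u t. u \<in> J \<Longrightarrow> lorentz (B u t) (B u t) = G u"
    and F: "continuous_on J F" and G: "continuous_on J G"
    and nz: "\<And>u. u \<in> J \<Longrightarrow> (cos \<theta>)\<^sup>2 * G u - (F u)\<^sup>2 \<noteq> 0"
    and N: "\<And>u. N u = 2 * F u * (sin \<theta>)\<^sup>2"
    and H: "\<And>u. H u = G u - (F u)\<^sup>2"
    and Q: "\<And>u. Q u = 2 * ((cos \<theta>)\<^sup>2 * G u - (F u)\<^sup>2)"
  shows "\<exists>s\<in>{1, -1::real}. \<forall>u\<in>J. \<alpha> u = S u (v u) \<and>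
    v u = (LBINT \<xi>=ereal u\<^sub>0..ereal u. (N \<xi> + s * sqrt ((sin (2 * \<theta>))\<^sup>2 * H \<xi>)) / Q \<xi>)"
proof -
  have v: "smooth_on J v" and \<alpha>: "\<And>u. u \<in> J \<Longrightarrow> \<alpha> u = S u (v u)"
    using lox X by (auto simp: spacelike_loxodrome_def)
  have Xu: "X_u J X u t = A u t" if "u \<in> J" for u t
  proof -
    \<comment> \<open>A constant \<open>w\<close>, with derivative \<open>0\<close>, turns the chain
      rule into the partial derivative along a meridian. Taking \<open>w = v\<close> below yields
      the tangent of the loxodrome.\<close>
    have "((\<lambda>s. S s t) has_vector_derivative A u t) (at u within J)"
      using dS[OF that, of "\<lambda>_. t" 0] by simp
    then have "((\<lambda>s. X s t) has_vector_derivative A u t) (at u within J)"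
      by (rule has_vector_derivative_transform[rotated 2]) (use that X in auto)
    then show ?thesis unfolding X_u_def by (rule D_eqI[OF J that])
  qed
  have Xv: "X_v X u t = B u t" if "u \<in> J" for u t
  proof -
    have "X u = S u" using X[OF that] by blast
    then show ?thesis
      unfolding X_v_def D_def using dS'[OF that, of t] by (simp add: vector_derivative_at)
  qed
  have D\<alpha>: "D J \<alpha> u = A u (v u) + D J v u *\<^sub>R B u (v u)" if "u \<in> J" for u
  proof -
    have "(v has_real_derivative D J v u) (at u within J)"
      using smooth_on_D[OF v that] by (simp add: has_real_derivative_iff_has_vector_derivative)
    from dS[OF that this] have "(\<alpha> has_vector_derivative A u (v u) + D J v u *\<^sub>R B u (v u)) (at u within J)"
      by (rule has_vector_derivative_transform[rotated 2]) (use that \<alpha> in auto)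
    then show ?thesis by (rule D_eqI[OF J that])
  qed
  have nd: "lorentz (A u (v u)) (A u (v u)) * lorentz (B u (v u)) (B u (v u))
      - (lorentz (A u (v u)) (B u (v u)))\<^sup>2 > 0" if "u \<in> J" for u
    using surf that Xu[OF that] Xv[OF that] unfolding spacelike_surface_def by metis
  have "\<exists>s\<in>{1, -1::real}. \<forall>u\<in>J. v u = (LBINT \<xi>=ereal u\<^sub>0..ereal u.
    (2 * F \<xi> * (sin \<theta>)\<^sup>2 + s * sqrt ((sin (2 * \<theta>))\<^sup>2 * (G \<xi> - (F \<xi>)\<^sup>2)))
      / (2 * ((cos \<theta>)\<^sup>2 * G \<xi> - (F \<xi>)\<^sup>2)))"
  proof (rule loxodrome_integral[OF J v F G _ _ nz u0])
    fix u assume u: "u \<in> J"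
    show "G u - (F u)\<^sup>2 > 0"
      using nd[OF u] AA[OF u] AB[OF u] BB[OF u] by simp
    show "(1 + D J v u * F u)\<^sup>2 = (cos \<theta>)\<^sup>2 * (1 + 2 * D J v u * F u + (D J v u)\<^sup>2 * G u)"
    proof -
      have "spacelike (D J \<alpha> u)" "spacelike (X_u J X u (v u))"
        "spacelike_subspace (span {D J \<alpha> u, X_u J X u (v u)})"
        "spacelike_angle (D J \<alpha> u) (X_u J X u (v u)) = \<theta>"
        using lox u by (simp_all add: spacelike_loxodrome_def)
      then show ?thesis
        using spacelike_angle_with_meridian[OF AA[OF u] nd[OF u], of "D J v u" \<theta>]
        unfolding D\<alpha>[OF u] Xu[OF u] AB[OF u] BB[OF u] by blast
    qed
  qed
  then show ?thesis unfolding N H Q using \<alpha> by blast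
qed

section \<open>The three types of helicoidal surface\<close>

lemma has_vector_derivative_scaleR_const:
  "(f has_real_derivative f') F \<Longrightarrow> ((\<lambda>s. f s *\<^sub>R a) has_vector_derivative f' *\<^sub>R a) F"
  unfolding has_real_derivative_iff_has_vector_derivative
  by (rule bounded_linear.has_vector_derivative[OF bounded_linear_scaleR_left])

lemmas frame_derivative_intros = has_vector_derivative_add has_vector_derivative_sum
  has_vector_derivative_const has_vector_derivative_scaleR_const

text \<open>The motion rotates the Euclidean plane of \<open>e 1\<close> and \<open>e 2\<close>, so
  the parameter \<open>t\<close> drops out of all products of partial derivatives by
  \<open>cos^2 + sin^2 = 1\<close>.\<close>

lemma loxodrome_I:
  fixes X :: "real \<Rightarrow> real \<Rightarrow> real ^ 'n::{finite,linorder}"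
  assumes surf: "spacelike_surface J X" and lox: "spacelike_loxodrome J X v \<theta> \<alpha>"
    and u0: "u\<^sub>0 \<in> J" "v u\<^sub>0 = 0" and hel: "helicoidal_I J 1 c x X"
    and nz: "\<forall>\<xi>\<in>J. (cos \<theta>)\<^sup>2 * ((x 1 \<xi>)\<^sup>2 - c\<^sup>2) - c\<^sup>2 * (D J (x CARD('n)) \<xi>)\<^sup>2 \<noteq> 0"
  shows "\<exists>s\<in>{1, -1::real}. \<forall>u\<in>J.
           \<alpha> u = surface_I c x u (v u) \<and>
           v u = (LBINT \<xi>=ereal u\<^sub>0..ereal u.
             (- 2 * c * (sin \<theta>)\<^sup>2 * D J (x CARD('n)) \<xi>
                + s * sqrt ((sin (2 * \<theta>))\<^sup>2
                        * ((x 1 \<xi>)\<^sup>2 - c\<^sup>2 * (1 + (D J (x CARD('n)) \<xi>)\<^sup>2))))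
             / (2 * (cos \<theta>)\<^sup>2 * ((x 1 \<xi>)\<^sup>2 - c\<^sup>2) - 2 * c\<^sup>2 * (D J (x CARD('n)) \<xi>)\<^sup>2))"
proof -
  let ?n = "CARD('n)"
  from hel have n: "?n \<ge> 3" and J: "nondegenerate_interval J"
    and \<beta>: "smooth_on J (beta_I x :: real \<Rightarrow> (real, 'n) vec)"
    and arc: "\<And>u. u \<in> J \<Longrightarrow> (D J (x 1) u)\<^sup>2
      + (\<Sum>i = 3..?n - 1. (D J (x i) u)\<^sup>2) - (D J (x ?n) u)\<^sup>2 = 1"
    and X: "\<And>u t. u \<in> J \<Longrightarrow> X u t = surface_I c x u t"
    unfolding helicoidal_I_def by blast+
  \<comment> \<open>in the form in which the simplifier meets them, with \<open>Suc 0\<close> for \<open>1\<close>\<close>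
  have idx: "\<not> ?n \<le> ?n - Suc 0" "?n \<noteq> 1" "?n \<noteq> 2" using n by linarith+
  \<comment> \<open>The time coordinate needs the factor \<open>-1\<close>, as \<open>e n\<close>
    has square \<open>-1\<close>.\<close>
  have "x i u = lorentz (beta_I x u :: (real, 'n) vec) ((if i = ?n then -1 else 1) *\<^sub>R e i)"
    if "i = 1 \<or> i \<in> {3..?n}" for i u
    using that n by (auto simp: beta_I_def lorentz_bilinear lorentz_frame)
  note x = smooth_on_lorentz_coordinate[OF J \<beta> this]
  let ?A = "\<lambda>u t. (D J (x 1) u * cos t) *\<^sub>R e 1 + (D J (x 1) u * sin t) *\<^sub>R e 2
    + (\<Sum>i = 3..?n - 1. D J (x i) u *\<^sub>R e i) + D J (x ?n) u *\<^sub>R e ?n :: (real, 'n) vec"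
  let ?B = "\<lambda>u t. (- x 1 u * sin t) *\<^sub>R e 1 + (x 1 u * cos t) *\<^sub>R e 2 + c *\<^sub>R e ?n :: (real, 'n) vec"
  let ?F = "\<lambda>u. - c * D J (x ?n) u" and ?G = "\<lambda>u. (x 1 u)\<^sup>2 - c\<^sup>2"
  show ?thesis
  proof (rule loxodrome_parametrization[OF surf lox u0 J X, where A = ?A and B = ?B and F = ?F and G = ?G])
    fix u t :: real and w w'
    assume u: "u \<in> J"
    show "((\<lambda>s. surface_I c x s (w s)) has_vector_derivative ?A u (w u) + w' *\<^sub>R ?B u (w u))
      (at u within J)" if w: "(w has_real_derivative w') (at u within J)"
    proof -
      \<comment> \<open>The derivative is first written with the summands of
        \<open>surface_I\<close> in their order, so that the sum rule applies term by term, and only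
        then regrouped.\<close>
      have "((\<lambda>s. surface_I c x s (w s) :: (real, 'n) vec) has_vector_derivative
        (D J (x 1) u * cos (w u) - w' * (x 1 u * sin (w u))) *\<^sub>R e 1
        + (D J (x 1) u * sin (w u) + w' * (x 1 u * cos (w u))) *\<^sub>R e 2
        + (\<Sum>i = 3..?n - 1. D J (x i) u *\<^sub>R e i)
        + (D J (x ?n) u + w' * c) *\<^sub>R e ?n) (at u within J)"
        unfolding surface_I_def using n u
        by (intro frame_derivative_intros) (auto intro!: derivative_eq_intros x(1) w)
      then show ?thesis by (simp add: algebra_simps)
    qed
    \<comment> \<open>The summand \<open>0\<close> is the derivative of the middle sum, which is
      constant in the second parameter.\<close>
    have "(surface_I c x u has_vector_derivative
      ((- x 1 u * sin t) *\<^sub>R e 1 + (x 1 u * cos t) *\<^sub>R e 2 + 0 + c *\<^sub>R e ?n :: (real, 'n) vec)) (at t)"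
      unfolding surface_I_def[abs_def]
      by (intro frame_derivative_intros) (auto intro!: derivative_eq_intros)
    then show "(surface_I c x u has_vector_derivative ?B u t) (at t)" by simp
    have "lorentz (?A u t) (?A u t) = (D J (x 1) u * cos t)\<^sup>2 + (D J (x 1) u * sin t)\<^sup>2
      + (\<Sum>i = 3..?n - 1. (D J (x i) u)\<^sup>2) - (D J (x ?n) u)\<^sup>2"
      using n by (simp add: lorentz_bilinear lorentz_frame idx power2_eq_square)
    also have "(D J (x 1) u * cos t)\<^sup>2 + (D J (x 1) u * sin t)\<^sup>2 = (D J (x 1) u)\<^sup>2"
      by (simp add: power_mult_distrib flip: distrib_left)
    finally show "lorentz (?A u t) (?A u t) = 1" using arc[OF u] by simp
    show "lorentz (?A u t) (?B u t) = ?F u"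
      using n by (simp add: lorentz_bilinear lorentz_frame idx)
    have "lorentz (?B u t) (?B u t) = (x 1 u * sin t)\<^sup>2 + (x 1 u * cos t)\<^sup>2 - c\<^sup>2"
      using n by (simp add: lorentz_bilinear lorentz_frame idx power2_eq_square)
    also have "(x 1 u * sin t)\<^sup>2 + (x 1 u * cos t)\<^sup>2 = (x 1 u)\<^sup>2"
      by (simp add: power_mult_distrib flip: distrib_left)
    finally show "lorentz (?B u t) (?B u t) = ?G u" .
    show "(cos \<theta>)\<^sup>2 * ?G u - (?F u)\<^sup>2 \<noteq> 0" using nz u by (simp add: power_mult_distrib)
  \<comment> \<open>What remains is the continuity of \<open>?F\<close> and \<open>?G\<close> and
    the rewriting of numerator, radicand and denominator.\<close>
  qed (use n in \<open>auto intro!: continuous_intros x(2,3) simp: power2_eq_square algebra_simps\<close>)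
qed

text \<open>The motion is now a boost in the Lorentzian plane of \<open>e (n - 1)\<close> and
  \<open>e n\<close>, and \<open>cosh^2 - sinh^2 = 1\<close> eliminates the parameter.\<close>

lemma loxodrome_II:
  fixes X :: "real \<Rightarrow> real \<Rightarrow> real ^ 'n::{finite,linorder}"
  assumes surf: "spacelike_surface J X" and lox: "spacelike_loxodrome J X v \<theta> \<alpha>"
    and u0: "u\<^sub>0 \<in> J" "v u\<^sub>0 = 0" and hel: "helicoidal_II J 1 c x X"
    and nz: "\<forall>\<xi>\<in>J. (cos \<theta>)\<^sup>2 * (c\<^sup>2 + (x CARD('n) \<xi>)\<^sup>2) - c\<^sup>2 * (D J (x 1) \<xi>)\<^sup>2 \<noteq> 0"
  shows "\<exists>s\<in>{1, -1::real}. \<forall>u\<in>J.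
           \<alpha> u = surface_II c x u (v u) \<and>
           v u = (LBINT \<xi>=ereal u\<^sub>0..ereal u.
             (2 * c * D J (x 1) \<xi> * (sin \<theta>)\<^sup>2
                + s * sqrt ((sin (2 * \<theta>))\<^sup>2
                        * ((x CARD('n) \<xi>)\<^sup>2 + c\<^sup>2 * (1 - (D J (x 1) \<xi>)\<^sup>2))))
             / (2 * (cos \<theta>)\<^sup>2 * (c\<^sup>2 + (x CARD('n) \<xi>)\<^sup>2) - 2 * c\<^sup>2 * (D J (x 1) \<xi>)\<^sup>2))"
proof -
  let ?n = "CARD('n)"
  from hel have n: "?n \<ge> 3" and J: "nondegenerate_interval J"
    and \<beta>: "smooth_on J (beta_II x :: real \<Rightarrow> (real, 'n) vec)"
    and arc: "\<And>u. u \<in> J \<Longrightarrow> (\<Sum>i = 1..?n - 2. (D J (x i) u)\<^sup>2) - (D J (x ?n) u)\<^sup>2 = 1"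
    and X: "\<And>u t. u \<in> J \<Longrightarrow> X u t = surface_II c x u t"
    unfolding helicoidal_II_def by blast+
  have idx: "?n - Suc 0 \<noteq> ?n" "?n \<noteq> ?n - Suc 0" "Suc 0 \<noteq> ?n - Suc 0"
    "\<not> ?n \<le> ?n - 2" "?n - Suc 0 \<noteq> Suc 0" "\<not> ?n - Suc 0 \<le> ?n - 2"
    using n by linarith+
  have "x i u = lorentz (beta_II x u :: (real, 'n) vec) ((if i = ?n then -1 else 1) *\<^sub>R e i)"
    if "i \<in> {1..?n - 2} \<or> i = ?n" for i u
    using that n by (auto simp: beta_II_def lorentz_bilinear lorentz_frame)
  note x = smooth_on_lorentz_coordinate[OF J \<beta> this]
  let ?A = "\<lambda>u t. D J (x 1) u *\<^sub>R e 1 + (\<Sum>i = 2..?n - 2. D J (x i) u *\<^sub>R e i)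
    + (D J (x ?n) u * sinh t) *\<^sub>R e (?n - 1) + (D J (x ?n) u * cosh t) *\<^sub>R e ?n :: (real, 'n) vec"
  let ?B = "\<lambda>u t. c *\<^sub>R e 1 + (x ?n u * cosh t) *\<^sub>R e (?n - 1)
    + (x ?n u * sinh t) *\<^sub>R e ?n :: (real, 'n) vec"
  let ?F = "\<lambda>u. c * D J (x 1) u" and ?G = "\<lambda>u. c\<^sup>2 + (x ?n u)\<^sup>2"
  \<comment> \<open>The translation singles out the first coordinate, while the arc length condition
    sums over all spatial ones. The split is legitimate as \<open>n - 2 \<ge> 1\<close>; for
    \<open>n = 3\<close> the remaining sum is empty.\<close>
  have split: "(\<Sum>i = 1..?n - 2. f i) = f 1 + (\<Sum>i = 2..?n - 2. f i)" for f :: "nat \<Rightarrow> real"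
    using n by (simp add: sum.atLeast_Suc_atMost numeral_2_eq_2)
  show ?thesis
  proof (rule loxodrome_parametrization[OF surf lox u0 J X, where A = ?A and B = ?B and F = ?F and G = ?G])
    fix u t :: real and w w'
    assume u: "u \<in> J"
    show "((\<lambda>s. surface_II c x s (w s)) has_vector_derivative ?A u (w u) + w' *\<^sub>R ?B u (w u))
      (at u within J)" if w: "(w has_real_derivative w') (at u within J)"
    proof -
      have "((\<lambda>s. surface_II c x s (w s) :: (real, 'n) vec) has_vector_derivative
        (D J (x 1) u + w' * c) *\<^sub>R e 1
        + (\<Sum>i = 2..?n - 2. D J (x i) u *\<^sub>R e i)
        + (D J (x ?n) u * sinh (w u) + w' * (x ?n u * cosh (w u))) *\<^sub>R e (?n - 1)
        + (D J (x ?n) u * cosh (w u) + w' * (x ?n u * sinh (w u))) *\<^sub>R e ?n)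
        (at u within J)"
        unfolding surface_II_def using n u
        by (intro frame_derivative_intros) (auto intro!: derivative_eq_intros x(1) w)
      then show ?thesis by (simp add: algebra_simps)
    qed
    have "(surface_II c x u has_vector_derivative
      (c *\<^sub>R e 1 + 0 + (x ?n u * cosh t) *\<^sub>R e (?n - 1) + (x ?n u * sinh t) *\<^sub>R e ?n :: (real, 'n) vec)) (at t)"
      unfolding surface_II_def[abs_def]
      by (intro frame_derivative_intros) (auto intro!: derivative_eq_intros)
    then show "(surface_II c x u has_vector_derivative ?B u t) (at t)" by simp
    have "lorentz (?A u t) (?A u t) = (\<Sum>i = 1..?n - 2. (D J (x i) u)\<^sup>2)
      - (D J (x ?n) u)\<^sup>2 * ((cosh t)\<^sup>2 - (sinh t)\<^sup>2)"
      using n unfolding split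
      by (simp add: lorentz_bilinear lorentz_frame idx) (simp add: power2_eq_square algebra_simps)
    then show "lorentz (?A u t) (?A u t) = 1" using arc[OF u] by (simp add: cosh_square_eq)
    show "lorentz (?A u t) (?B u t) = ?F u"
      using n by (simp add: lorentz_bilinear lorentz_frame idx)
    have "lorentz (?B u t) (?B u t) = c\<^sup>2 + (x ?n u)\<^sup>2 * ((cosh t)\<^sup>2 - (sinh t)\<^sup>2)"
      using n by (simp add: lorentz_bilinear lorentz_frame idx) (simp add: power2_eq_square algebra_simps)
    then show "lorentz (?B u t) (?B u t) = ?G u" by (simp add: cosh_square_eq)
    show "(cos \<theta>)\<^sup>2 * ?G u - (?F u)\<^sup>2 \<noteq> 0" using nz u by (simp add: power_mult_distrib)
  qed (use n in \<open>auto intro!: continuous_intros x(2,3) simp: power2_eq_square algebra_simps\<close>)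
qed

text \<open>The motion is a null rotation. The factor \<open>sqrt 2\<close> makes the
  \<open>t^2\<close> term from \<open>e 2\<close> cancel the one from the pair
  \<open>xi_pred\<close>, \<open>xi_last\<close>, and since \<open>xi_pred\<close> is null only the
  \<open>e 2\<close> component contributes to the square of \<open>?B\<close>.\<close>

lemma loxodrome_III:
  fixes X :: "real \<Rightarrow> real \<Rightarrow> real ^ 'n::{finite,linorder}"
  assumes surf: "spacelike_surface J X" and lox: "spacelike_loxodrome J X v \<theta> \<alpha>"
    and u0: "u\<^sub>0 \<in> J" "v u\<^sub>0 = 0" and hel: "helicoidal_III J 1 c x X"
    and nz: "\<forall>\<xi>\<in>J. 2 * (cos \<theta>)\<^sup>2 * (x CARD('n) \<xi>)\<^sup>2 - c\<^sup>2 * (D J (x CARD('n)) \<xi>)\<^sup>2 \<noteq> 0"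
  shows "\<exists>s\<in>{1, -1::real}. \<forall>u\<in>J.
           \<alpha> u = surface_III c x u (v u) \<and>
           v u = (LBINT \<xi>=ereal u\<^sub>0..ereal u.
             (- 2 * c * D J (x CARD('n)) \<xi> * (sin \<theta>)\<^sup>2
                + s * sqrt ((sin (2 * \<theta>))\<^sup>2
                        * (2 * (x CARD('n) \<xi>)\<^sup>2 - c\<^sup>2 * (D J (x CARD('n)) \<xi>)\<^sup>2)))
             / (4 * (cos \<theta>)\<^sup>2 * (x CARD('n) \<xi>)\<^sup>2 - 2 * c\<^sup>2 * (D J (x CARD('n)) \<xi>)\<^sup>2))"
proof -
  let ?n = "CARD('n)"
  from hel have n: "?n \<ge> 4" and J: "nondegenerate_interval J"
    and \<beta>: "smooth_on J (beta_III x :: real \<Rightarrow> (real, 'n) vec)"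
    and arc: "\<And>u. u \<in> J \<Longrightarrow> (D J (x 1) u)\<^sup>2 + (\<Sum>i = 3..?n - 2. (D J (x i) u)\<^sup>2)
      - 2 * D J (x (?n - 1)) u * D J (x ?n) u = 1"
    and X: "\<And>u t. u \<in> J \<Longrightarrow> X u t = surface_III c x u t"
    unfolding helicoidal_III_def by blast+
  have "x i u = lorentz (beta_III x u :: (real, 'n) vec) (e i)"
    if "i = 1 \<or> i \<in> {3..?n - 2}" for i u
    using that n by (auto simp: beta_III_def lorentz_bilinear lorentz_frame lorentz_null_frame)
  note x = smooth_on_lorentz_coordinate[OF J \<beta> this]
  \<comment> \<open>In a null frame each coefficient is read off by the opposite vector: the product
    of \<open>xi_pred\<close> and \<open>xi_last\<close> is \<open>-1\<close>, and both have square
    \<open>0\<close>.\<close>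
  have "x ?n u = lorentz (beta_III x u :: (real, 'n) vec) ((-1) *\<^sub>R xi_pred)"
    "x (?n - 1) u = lorentz (beta_III x u :: (real, 'n) vec) ((-1) *\<^sub>R xi_last)" for u
    using n by (auto simp: beta_III_def lorentz_bilinear lorentz_null_frame)
  \<comment> \<open>\<open>y(1-3)\<close> concern \<open>x n\<close> and \<open>y(4-6)\<close>
    concern \<open>x (n - 1)\<close>.\<close>
  note y = smooth_on_lorentz_coordinate[OF J \<beta> this(1)] smooth_on_lorentz_coordinate[OF J \<beta> this(2)]
  let ?A = "\<lambda>u t. D J (x 1) u *\<^sub>R e 1 + (sqrt 2 * t * D J (x ?n) u) *\<^sub>R e 2
    + (\<Sum>i = 3..?n - 2. D J (x i) u *\<^sub>R e i)
    + (D J (x (?n - 1)) u + t\<^sup>2 * D J (x ?n) u) *\<^sub>R xi_pred + D J (x ?n) u *\<^sub>R xi_last :: (real, 'n) vec"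
  let ?B = "\<lambda>u t. (sqrt 2 * x ?n u) *\<^sub>R e 2 + (2 * t * x ?n u + c) *\<^sub>R xi_pred :: (real, 'n) vec"
  let ?F = "\<lambda>u. - c * D J (x ?n) u" and ?G = "\<lambda>u. 2 * (x ?n u)\<^sup>2"
  show ?thesis
  proof (rule loxodrome_parametrization[OF surf lox u0 J X, where A = ?A and B = ?B and F = ?F and G = ?G])
    fix u t :: real and w w'
    assume u: "u \<in> J"
    show "((\<lambda>s. surface_III c x s (w s)) has_vector_derivative ?A u (w u) + w' *\<^sub>R ?B u (w u))
      (at u within J)" if w: "(w has_real_derivative w') (at u within J)"
    proof -
      have "((\<lambda>s. surface_III c x s (w s) :: (real, 'n) vec) has_vector_derivative
        D J (x 1) u *\<^sub>R e 1 + (sqrt 2 * w u * D J (x ?n) u + w' * (sqrt 2 * x ?n u)) *\<^sub>R e 2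
        + (\<Sum>i = 3..?n - 2. D J (x i) u *\<^sub>R e i)
        + (D J (x (?n - 1)) u + (w u)\<^sup>2 * D J (x ?n) u + w' * (2 * w u * x ?n u + c)) *\<^sub>R xi_pred
        + D J (x ?n) u *\<^sub>R xi_last) (at u within J)"
        unfolding surface_III_def using n u
        by (intro frame_derivative_intros)
          (auto intro!: derivative_eq_intros x(1) y(1,4)[simplified] w simp: algebra_simps)
      then show ?thesis by (simp add: algebra_simps)
    qed
    have "(surface_III c x u has_vector_derivative
      (0 + (sqrt 2 * x ?n u) *\<^sub>R e 2 + 0 + (2 * t * x ?n u + c) *\<^sub>R xi_pred + 0 :: (real, 'n) vec)) (at t)"
      unfolding surface_III_def[abs_def]
      by (intro frame_derivative_intros) (auto intro!: derivative_eq_intros)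
    then show "(surface_III c x u has_vector_derivative ?B u t) (at t)" by simp
    have "lorentz (?A u t) (?A u t) = (D J (x 1) u)\<^sup>2 + (sqrt 2)\<^sup>2 * t\<^sup>2 * (D J (x ?n) u)\<^sup>2
      + (\<Sum>i = 3..?n - 2. (D J (x i) u)\<^sup>2)
      - 2 * (D J (x (?n - 1)) u + t\<^sup>2 * D J (x ?n) u) * D J (x ?n) u"
      using n by (simp add: lorentz_bilinear lorentz_frame lorentz_null_frame)
        (simp add: power2_eq_square algebra_simps)
    then show "lorentz (?A u t) (?A u t) = 1"
      using arc[OF u] by (simp add: power2_eq_square algebra_simps)
    show "lorentz (?A u t) (?B u t) = ?F u"
      using n by (simp add: lorentz_bilinear lorentz_frame lorentz_null_frame)
        (simp add: algebra_simps)
    show "lorentz (?B u t) (?B u t) = ?G u"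
      using n by (simp add: lorentz_bilinear lorentz_frame lorentz_null_frame)
        (simp add: power2_eq_square algebra_simps)
    show "(cos \<theta>)\<^sup>2 * ?G u - (?F u)\<^sup>2 \<noteq> 0"
      using nz u by (simp add: power_mult_distrib mult.left_commute mult.assoc)
  qed (use n in \<open>auto intro!: continuous_intros x(2,3) y(2,3) simp: power2_eq_square algebra_simps\<close>)
qed

theorem theorem3p1:
  fixes J :: "real set"
    and c \<theta>\<^sub>0 u\<^sub>0 :: real
    and x :: "nat \<Rightarrow> real \<Rightarrow> real"
    and X :: "real \<Rightarrow> real \<Rightarrow> real ^ 'n::{finite,linorder}"
    and v :: "real \<Rightarrow> real"
    and \<alpha> :: "real \<Rightarrow> real ^ 'n::{finite,linorder}"
  assumes "spacelike_surface J X"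
    and "spacelike_loxodrome J X v \<theta>\<^sub>0 \<alpha>"
    and "u\<^sub>0 \<in> J"
    and "v u\<^sub>0 = 0"
  shows
    "(helicoidal_I J 1 c x X \<longrightarrow>
        (\<forall>\<xi>\<in>J. (cos \<theta>\<^sub>0)\<^sup>2 * ((x 1 \<xi>)\<^sup>2 - c\<^sup>2) - c\<^sup>2 * (D J (x CARD('n)) \<xi>)\<^sup>2 \<noteq> 0) \<longrightarrow>
        (\<exists>s\<in>{1, -1::real}. \<forall>u\<in>J.
           \<alpha> u = surface_I c x u (v u) \<and>
           v u = (LBINT \<xi>=ereal u\<^sub>0..ereal u.
             (- 2 * c * (sin \<theta>\<^sub>0)\<^sup>2 * D J (x CARD('n)) \<xi>
                + s * sqrt ((sin (2 * \<theta>\<^sub>0))\<^sup>2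
                        * ((x 1 \<xi>)\<^sup>2 - c\<^sup>2 * (1 + (D J (x CARD('n)) \<xi>)\<^sup>2))))
             / (2 * (cos \<theta>\<^sub>0)\<^sup>2 * ((x 1 \<xi>)\<^sup>2 - c\<^sup>2) - 2 * c\<^sup>2 * (D J (x CARD('n)) \<xi>)\<^sup>2))))
   \<and> (helicoidal_II J 1 c x X \<longrightarrow>
        (\<forall>\<xi>\<in>J. (cos \<theta>\<^sub>0)\<^sup>2 * (c\<^sup>2 + (x CARD('n) \<xi>)\<^sup>2) - c\<^sup>2 * (D J (x 1) \<xi>)\<^sup>2 \<noteq> 0) \<longrightarrow>
        (\<exists>s\<in>{1, -1::real}. \<forall>u\<in>J.
           \<alpha> u = surface_II c x u (v u) \<and>
           v u = (LBINT \<xi>=ereal u\<^sub>0..ereal u.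
             (2 * c * D J (x 1) \<xi> * (sin \<theta>\<^sub>0)\<^sup>2
                + s * sqrt ((sin (2 * \<theta>\<^sub>0))\<^sup>2
                        * ((x CARD('n) \<xi>)\<^sup>2 + c\<^sup>2 * (1 - (D J (x 1) \<xi>)\<^sup>2))))
             / (2 * (cos \<theta>\<^sub>0)\<^sup>2 * (c\<^sup>2 + (x CARD('n) \<xi>)\<^sup>2) - 2 * c\<^sup>2 * (D J (x 1) \<xi>)\<^sup>2))))
   \<and> (helicoidal_III J 1 c x X \<longrightarrow>
        (\<forall>\<xi>\<in>J. 2 * (cos \<theta>\<^sub>0)\<^sup>2 * (x CARD('n) \<xi>)\<^sup>2 - c\<^sup>2 * (D J (x CARD('n)) \<xi>)\<^sup>2 \<noteq> 0) \<longrightarrow>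
        (\<exists>s\<in>{1, -1::real}. \<forall>u\<in>J.
           \<alpha> u = surface_III c x u (v u) \<and>
           v u = (LBINT \<xi>=ereal u\<^sub>0..ereal u.
             (- 2 * c * D J (x CARD('n)) \<xi> * (sin \<theta>\<^sub>0)\<^sup>2
                + s * sqrt ((sin (2 * \<theta>\<^sub>0))\<^sup>2
                        * (2 * (x CARD('n) \<xi>)\<^sup>2 - c\<^sup>2 * (D J (x CARD('n)) \<xi>)\<^sup>2)))
             / (4 * (cos \<theta>\<^sub>0)\<^sup>2 * (x CARD('n) \<xi>)\<^sup>2 - 2 * c\<^sup>2 * (D J (x CARD('n)) \<xi>)\<^sup>2))))"
  using loxodrome_I[OF assms] loxodrome_II[OF assms] loxodrome_III[OF assms] by blast

end
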